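(* Fix a fraction of deletions $\delta\in[0,1/2]$, $\varepsilon>0$, and $\alpha\in[0,1]$, and let $R=1-h(\delta)+\varepsilon$. Suppose that $\mathcal{C}$ is the code of block length $n$ obtained by independently sampling $2^{Rn}$ codewords in $\{0,1\}^n$, each distributed according to an order-$1$ Markov chain $X_1,\dots,X_n$ with each $X_i\in\{0,1\}$, $\Pr[X_1=1]=1/2$, and $\Pr[X_i=X_{i-1}]=\alpha$ for $i>1$, and keeping repeated codewords. Then, with high probability (i.e., with probability tending to $1$ as $n\to\infty$), there exists $y\in\{0,1\}^{(1-\delta)n}$ such that $$|\{c\in\mathcal{C}: y \text{ is a subsequence of } c\}|\geq 2^{\Omega(\varepsilon n)}.$$
   Context: $h(p)=-p\log p-(1-p)\log(1-p)$ is the binary entropy function, with $\log$ base $2$ and $h(0)=h(1)=0$. A string $y$ is a subsequence of $c$ if $y$ is obtained from $c$ by deleting some (possibly none) of its symbols. The code $\mathcal{C}$ is regarded as a multiset of $2^{Rn}$ codewords (up to rounding to an integer), and codewords are counted with multiplicity. The Markov chain is symmetric: $X_1$ is uniform on $\{0,1\}$ and, for $i>1$, conditioned on the past $X_1,\dots,X_{i-1}$, $X_i$ equals $X_{i-1}$ with probability $\alpha$ and $1-X_{i-1}$ with probability $1-\alpha$. For simplicity $\delta n$ is assumed to be an integer. The bound $2^{\Omega(\varepsilon n)}$ means $2^{c\varepsilon n}$ for an absolute constant $c>0$, for all sufficiently large $n$. *)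

theory Defs
  imports "HOL-Probability.Probability" "HOL-Library.Sublist"
begin

(* At p = 0 and p = 1 the convention h(0) = h(1) = 0 comes out of log 2 0 = 0. *)
definition bin_entropy :: "real \<Rightarrow> real" where
  "bin_entropy p = - p * log 2 p - (1 - p) * log 2 (1 - p)"

lemma bin_entropy_0 [simp]: "bin_entropy 0 = 0"
  and bin_entropy_1 [simp]: "bin_entropy 1 = 0"
  by (simp_all add: bin_entropy_def)

(* True stands for the symbol 1. *)
definition markov_step :: "real \<Rightarrow> bool \<Rightarrow> bool pmf" where
  "markov_step \<alpha> b = map_pmf (\<lambda>same. if same then b else \<not> b) (bernoulli_pmf \<alpha>)"

(* The next n symbols of the chain when its current symbol is b. *)
primrec markov_from :: "real \<Rightarrow> nat \<Rightarrow> bool \<Rightarrow> bool list pmf" where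
  "markov_from \<alpha> 0 b = return_pmf []"
| "markov_from \<alpha> (Suc n) b =
     bind_pmf (markov_step \<alpha> b) (\<lambda>b'. map_pmf ((#) b') (markov_from \<alpha> n b'))"

fun markov_word :: "real \<Rightarrow> nat \<Rightarrow> bool list pmf" where
  "markov_word \<alpha> 0 = return_pmf []"
| "markov_word \<alpha> (Suc n) =
     bind_pmf (bernoulli_pmf (1/2)) (\<lambda>b. map_pmf ((#) b) (markov_from \<alpha> n b))"

definition random_code :: "nat \<Rightarrow> real \<Rightarrow> nat \<Rightarrow> bool list multiset pmf" where
  "random_code M \<alpha> n = map_pmf mset (replicate_pmf M (markov_word \<alpha> n))"

end

theory Submission
  imports Defs "HOL-Real_Asymp.Real_Asymp"
begin

text \<open>Some fixed word \<open>y\<close> of length \<open>m = n - \<lfloor>\<delta>n\<rfloor>\<close> is a subsequence of the Markov word with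
  probability at least \<open>(n choose m) / (2 ^ n (n + 1))\<close>, which is \<open>2 ^ (-(1 - h(\<delta>)) n)\<close> up to a
  polynomial factor. For \<open>\<alpha> \<le> 1/2\<close> the alternating word works, as the chain flips at each step with
  probability at least \<open>1/2\<close>. For \<open>\<alpha> \<ge> 1/2\<close> the constant word works: the number of ones dominates a
  fair binomial variable in convex order, so testing against \<open>(j - m + 1)\<^sup>+\<close> compares the tails
  at the cost of a factor \<open>n + 1\<close>. The expected number of codewords above \<open>y\<close> is then at least
  \<open>2 ^ (\<epsilon>n)\<close> up to a polynomial factor, and a Chernoff bound gives \<open>c = 1/2\<close>.\<close>

section \<open>Expectations under the Markov chain\<close>

lemma expectation_bind_bernoulli_pmf:
  fixes h :: "'a \<Rightarrow> real"
  assumes "0 \<le> p" "p \<le> 1" "finite (set_pmf (f True))" "finite (set_pmf (f False))"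
  shows "measure_pmf.expectation (bernoulli_pmf p \<bind> f) h =
    p * measure_pmf.expectation (f True) h + (1 - p) * measure_pmf.expectation (f False) h"
proof -
  have "finite (set_pmf (f x))" for x
    using assms by (cases x) auto
  then show ?thesis
    using assms by (subst pmf_expectation_bind[of UNIV]) (auto simp: UNIV_bool)
qed

lemma finite_set_markov_from: "finite (set_pmf (markov_from \<alpha> n b))"
  by (induction n arbitrary: b) auto

lemma expectation_markov_from_Suc:
  fixes h :: "bool list \<Rightarrow> real"
  assumes "0 \<le> \<alpha>" "\<alpha> \<le> 1"
  shows "measure_pmf.expectation (markov_from \<alpha> (Suc n) b) h =
    \<alpha> * measure_pmf.expectation (markov_from \<alpha> n b) (\<lambda>w. h (b # w))
    + (1 - \<alpha>) * measure_pmf.expectation (markov_from \<alpha> n (\<not> b)) (\<lambda>w. h ((\<not> b) # w))"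
  using assms finite_set_markov_from
  by (simp add: markov_step_def bind_map_pmf expectation_bind_bernoulli_pmf)

lemma expectation_markov_word_Suc:
  fixes h :: "bool list \<Rightarrow> real"
  assumes "0 \<le> \<alpha>" "\<alpha> \<le> 1"
  shows "measure_pmf.expectation (markov_word \<alpha> (Suc n)) h =
    (measure_pmf.expectation (markov_from \<alpha> n True) (\<lambda>w. h (True # w))
      + measure_pmf.expectation (markov_from \<alpha> n False) (\<lambda>w. h (False # w))) / 2"
  using finite_set_markov_from
  by (simp add: expectation_bind_bernoulli_pmf)

lemma finite_set_markov_word: "finite (set_pmf (markov_word \<alpha> n))"
  using finite_set_markov_from by (cases n) auto

lemma length_markov_word:
  assumes "w \<in> set_pmf (markov_word \<alpha> n)"
  shows "length w = n"
proof -
  have len: "w \<in> set_pmf (markov_from \<alpha> n b) \<Longrightarrow> length w = n" for n b w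
    by (induction n arbitrary: b w) auto
  show ?thesis
    using assms by (cases n) (auto dest: len)
qed

lemma expectation_mono_finite:
  fixes f g :: "'a \<Rightarrow> real"
  assumes "finite (set_pmf p)" "\<And>x. x \<in> set_pmf p \<Longrightarrow> f x \<le> g x"
  shows "measure_pmf.expectation p f \<le> measure_pmf.expectation p g"
  using assms
  by (intro integral_mono_AE integrable_measure_pmf_finite) (auto simp: AE_measure_pmf_iff)

section \<open>Alternating words\<close>

primrec alternating :: "nat \<Rightarrow> bool \<Rightarrow> bool list" where
  "alternating 0 b = []"
| "alternating (Suc m) b = b # alternating m (\<not> b)"

lemma length_alternating [simp]: "length (alternating m b) = m"
  by (induction m arbitrary: b) auto

text \<open>\<open>alternating m b\<close> is a prefix of \<open>alternating (Suc m) b\<close>, so a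
  shorter target is at least as likely to be found.\<close>

lemma subseq_alternating_SucD:
  assumes "subseq (alternating (Suc m) b) w"
  shows "subseq (alternating m b) w"
proof -
  have "subseq (alternating m b) (alternating (Suc m) b)"
  proof (induction m arbitrary: b)
    case (Suc m)
    from Suc[of "\<not> b"] show ?case by simp
  qed simp
  then show ?thesis
    using assms by (rule subseq_order.trans)
qed

text \<open>The difference of the two sides is \<open>(1/2 - a) * (x - y)\<close>: moving weight
  from the smaller to the larger value raises the average.\<close>

lemma half_sum_le_convex_combination:
  fixes x y a :: real
  assumes "y \<le> x" "a \<le> 1/2"
  shows "(x + y) / 2 \<le> a * y + (1 - a) * x"
proof -
  have "a * y + (1 - a) * x - (x + y) / 2 = (1/2 - a) * (x - y)"
    by (simp add: field_simps)
  moreover have "0 \<le> (1/2 - a) * (x - y)"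
    using assms by (intro mult_nonneg_nonneg) auto
  ultimately show ?thesis by linarith
qed

text \<open>Greedy matching advances exactly when the chain flips, which happens with probability
  \<open>1 - \<alpha> \<ge> 1/2\<close>; Pascal's rule then compares with \<open>n\<close> fair coins.\<close>

lemma expectation_subseq_alternating:
  assumes "0 \<le> \<alpha>" "\<alpha> \<le> 1/2"
  shows "real (n choose m) / 2 ^ n \<le>
    measure_pmf.expectation (markov_from \<alpha> n b) (\<lambda>w. of_bool (subseq (alternating m (\<not> b)) w))"
proof (induction n arbitrary: m b)
  case 0
  show ?case by (cases m) auto
next
  case (Suc n)
  have \<alpha>: "0 \<le> \<alpha>" "\<alpha> \<le> 1" using assms by auto
  show ?case
  proof (cases m)
    case 0
    then show ?thesis
      using one_le_power[of "2::real" "Suc n"] by (simp add: divide_simps)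
  next
    case m: (Suc m')
    \<comment> \<open>The target starts with the opposite of the current symbol, so a flip matches
      its first letter and staying matches nothing.\<close>
    define g where "g m b =
      measure_pmf.expectation (markov_from \<alpha> n b) (\<lambda>w. of_bool (subseq (alternating m (\<not> b)) w) :: real)"
      for m b
    \<comment> \<open>Complementing all symbols carries the chain from \<open>b\<close> to the chain
      from \<open>\<not> b\<close>. This is needed because a flip leaves the chain at
      \<open>\<not> b\<close>, while the comparison below is between values at
      \<open>b\<close>.\<close>
    have flip: "g m b = g m (\<not> b)" for m b
    proof -
      have E: "measure_pmf.expectation (markov_from \<alpha> n b) h
        = measure_pmf.expectation (markov_from \<alpha> n (\<not> b)) (\<lambda>w. h (map Not w))" for n b and h :: "bool list \<Rightarrow> real"
      proof (induction n arbitrary: b h)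
        case (Suc n)
        from Suc[of b "\<lambda>w. h (b # w)"] Suc[of "\<not> b" "\<lambda>w. h ((\<not> b) # w)"] show ?case
          by (simp add: expectation_markov_from_Suc[OF \<alpha>] del: markov_from.simps(2))
      qed simp
      have alt: "alternating m (\<not> b) = map Not (alternating m b)" for m b
        by (induction m arbitrary: b) (auto simp: comp_def)
      have "inj Not" by (auto simp: inj_def)
      then have "subseq (map Not u) (map Not w) = subseq u w" for u w
        using subseq_map[of u w Not] subseq_map[of "map Not u" "map Not w" Not]
        by (auto simp: comp_def)
      then show ?thesis
        unfolding g_def by (subst E) (auto simp: alt)
    qed
    have "g m b \<le> g m' b"
      unfolding g_def m
      using subseq_alternating_SucD[of m' "\<not> b"] finite_set_markov_from
      by (intro expectation_mono_finite) auto
    have "real (Suc n choose m) / 2 ^ Suc n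
        = (real (n choose m') / 2 ^ n + real (n choose m) / 2 ^ n) / 2"
      by (simp add: m field_simps)
    also have "\<dots> \<le> (g m' b + g m b) / 2"
      using Suc.IH unfolding g_def by (intro divide_right_mono add_mono) auto
    also have "\<dots> \<le> \<alpha> * g m b + (1 - \<alpha>) * g m' b"
      using assms \<open>g m b \<le> g m' b\<close> by (intro half_sum_le_convex_combination) auto
    \<comment> \<open>Staying leaves the whole target, with value \<open>g m b\<close>; flipping
      leaves one letter less, with value \<open>g m' (\<not> b)\<close>.\<close>
    also have "\<dots> = measure_pmf.expectation (markov_from \<alpha> (Suc n) b)
        (\<lambda>w. of_bool (subseq (alternating m (\<not> b)) w))"
      using flip[of m' b] unfolding expectation_markov_from_Suc[OF \<alpha>] g_def m by simp
    finally show ?thesis .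
  qed
qed

text \<open>The first symbol is a fair coin: \<open>True\<close> matches the first letter,
  \<open>False\<close> leaves the chain one flip away from it. The bounds for the two cases combine
  by Pascal's rule.\<close>

lemma expectation_subseq_alternating_word:
  assumes "0 \<le> \<alpha>" "\<alpha> \<le> 1/2"
  shows "real (n choose m) / 2 ^ n \<le>
    measure_pmf.expectation (markov_word \<alpha> n) (\<lambda>w. of_bool (subseq (alternating m True) w))"
proof (cases n)
  case 0
  then show ?thesis by (cases m) auto
next
  case (Suc n')
  show ?thesis
  proof (cases m)
    case 0
    then show ?thesis by (simp add: divide_simps)
  next
    case m: (Suc m')
    have \<alpha>: "0 \<le> \<alpha>" "\<alpha> \<le> 1" using assms by auto
    show ?thesis
      using expectation_subseq_alternating[OF assms, of n' m' True]
        expectation_subseq_alternating[OF assms, of n' m False]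
      unfolding Suc expectation_markov_word_Suc[OF \<alpha>] m
      by (simp add: field_simps)
  qed
qed

section \<open>Constant words\<close>

definition convex_nat :: "(nat \<Rightarrow> real) \<Rightarrow> bool" where
  "convex_nat \<phi> \<longleftrightarrow> (\<forall>j. \<phi> (Suc j) - \<phi> j \<le> \<phi> (Suc (Suc j)) - \<phi> (Suc j))"

text \<open>The current symbol \<open>b\<close> is not counted; to include it when it is
  \<open>True\<close>, \<open>\<phi>\<close> has to be shifted by one.\<close>

abbreviation expect_ones :: "real \<Rightarrow> nat \<Rightarrow> bool \<Rightarrow> (nat \<Rightarrow> real) \<Rightarrow> real" where
  "expect_ones \<alpha> n b \<phi> \<equiv> measure_pmf.expectation (markov_from \<alpha> n b) (\<lambda>w. \<phi> (count_list w True))"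

lemma expect_ones_Suc:
  assumes "0 \<le> \<alpha>" "\<alpha> \<le> 1"
  shows "expect_ones \<alpha> (Suc n) True \<phi> =
      \<alpha> * expect_ones \<alpha> n True (\<lambda>j. \<phi> (Suc j)) + (1 - \<alpha>) * expect_ones \<alpha> n False \<phi>"
    and "expect_ones \<alpha> (Suc n) False \<phi> =
      \<alpha> * expect_ones \<alpha> n False \<phi> + (1 - \<alpha>) * expect_ones \<alpha> n True (\<lambda>j. \<phi> (Suc j))"
  by (simp_all add: expectation_markov_from_Suc[OF assms] del: markov_from.simps(2))

text \<open>The next symbol is \<open>True\<close> with probability \<open>\<alpha>\<close> after
  \<open>True\<close> but only \<open>1 - \<alpha>\<close> after \<open>False\<close>. The gap
  between the two starts is therefore at least \<open>2 * \<alpha> - 1\<close> times the gap for one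
  step less.\<close>

lemma expect_ones_mono_start:
  assumes "1/2 \<le> \<alpha>" "\<alpha> \<le> 1" "mono \<psi>"
  shows "expect_ones \<alpha> n False \<psi> \<le> expect_ones \<alpha> n True (\<lambda>j. \<psi> (Suc j))"
  using assms(3)
proof (induction n arbitrary: \<psi>)
  case 0
  then show ?case by (simp add: mono_def)
next
  case (Suc n)
  have \<alpha>: "0 \<le> \<alpha>" "\<alpha> \<le> 1" using assms by auto
  have shift: "mono (\<lambda>j. \<psi> (Suc j))"
    using Suc.prems by (auto simp: mono_def)
  have "expect_ones \<alpha> n True (\<lambda>j. \<psi> (Suc j)) \<le> expect_ones \<alpha> n True (\<lambda>j. \<psi> (Suc (Suc j)))"
    "expect_ones \<alpha> n False \<psi> \<le> expect_ones \<alpha> n False (\<lambda>j. \<psi> (Suc j))"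
    using Suc.prems finite_set_markov_from
    by (auto intro!: expectation_mono_finite simp: mono_def)
  then have "\<alpha> * expect_ones \<alpha> n True (\<lambda>j. \<psi> (Suc j)) + (1 - \<alpha>) * expect_ones \<alpha> n False \<psi>
    \<le> expect_ones \<alpha> (Suc n) True (\<lambda>j. \<psi> (Suc j))"
    unfolding expect_ones_Suc(1)[OF \<alpha>, of n "\<lambda>j. \<psi> (Suc j)"] using \<alpha> by (intro add_mono mult_left_mono) auto
  moreover have "0 \<le> (2 * \<alpha> - 1) * (expect_ones \<alpha> n True (\<lambda>j. \<psi> (Suc j)) - expect_ones \<alpha> n False \<psi>)"
    using Suc.IH[OF Suc.prems] assms by (intro mult_nonneg_nonneg) auto
  ultimately show ?case
    unfolding expect_ones_Suc(2)[OF \<alpha>] by (simp add: algebra_simps)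
qed

text \<open>Pascal's rule as conditioning on one fair coin, which either shifts
  \<open>\<phi>\<close> or leaves it.\<close>

lemma sum_choose_Suc:
  fixes \<phi> :: "nat \<Rightarrow> real"
  shows "(\<Sum>j\<le>Suc n. real (Suc n choose j) * \<phi> j)
    = (\<Sum>j\<le>n. real (n choose j) * \<phi> (Suc j)) + (\<Sum>j\<le>n. real (n choose j) * \<phi> j)"
proof -
  have "(\<Sum>j\<le>n. real (n choose Suc j) * \<phi> (Suc j)) + \<phi> 0 = (\<Sum>j\<le>Suc n. real (n choose j) * \<phi> j)"
    by (simp add: sum.atMost_Suc_shift del: sum.atMost_Suc)
  moreover have "(\<Sum>j\<le>Suc n. real (n choose j) * \<phi> j) = (\<Sum>j\<le>n. real (n choose j) * \<phi> j)"
    by simp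
  moreover have "(\<Sum>j\<le>Suc n. real (Suc n choose j) * \<phi> j)
    = \<phi> 0 + (\<Sum>j\<le>n. (real (n choose j) + real (n choose Suc j)) * \<phi> (Suc j))"
    by (simp add: sum.atMost_Suc_shift del: sum.atMost_Suc)
  ultimately show ?thesis
    by (simp add: sum.distrib distrib_right binomial_eq_0)
qed

text \<open>The left side is the expectation of \<open>\<phi>\<close> under a fair binomial
  variable. Letting the second symbol agree with the first with probability \<open>\<alpha>\<close>
  instead of \<open>1/2\<close> moves mass to the extremes, which a convex \<open>\<phi>\<close>
  rewards.\<close>

lemma expect_ones_convex:
  assumes "1/2 \<le> \<alpha>" "\<alpha> \<le> 1" "convex_nat \<phi>"
  shows "(\<Sum>j\<le>n. real (n choose j) * \<phi> j) / 2 ^ n \<le>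
    measure_pmf.expectation (markov_word \<alpha> n) (\<lambda>w. \<phi> (count_list w True))"
proof (cases n)
  case 0
  then show ?thesis by simp
next
  case (Suc n')
  have \<alpha>: "0 \<le> \<alpha>" "\<alpha> \<le> 1" using assms by auto
  have "(\<Sum>j\<le>Suc n. real (Suc n choose j) * \<phi> j) / 2 ^ Suc n
    \<le> (expect_ones \<alpha> n True (\<lambda>j. \<phi> (Suc j)) + expect_ones \<alpha> n False \<phi>) / 2" for n
    using assms(3)
  proof (induction n arbitrary: \<phi>)
    case 0
    then show ?case by simp
  next
    case (Suc n)
    have conv: "convex_nat (\<lambda>j. \<phi> (Suc j))"
      using Suc.prems by (auto simp: convex_nat_def)
    \<comment> \<open>The increments of a convex function are monotone, so the comparison of
      starting symbols applies to them.\<close>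
    define \<psi> where "\<psi> j = \<phi> (Suc j) - \<phi> j" for j
    have "mono \<psi>"
      using Suc.prems by (auto simp: \<psi>_def convex_nat_def mono_iff_le_Suc)
    from expect_ones_mono_start[OF assms(1,2) this]
    have "expect_ones \<alpha> n False (\<lambda>j. \<phi> (Suc j)) - expect_ones \<alpha> n False \<phi>
      \<le> expect_ones \<alpha> n True (\<lambda>j. \<phi> (Suc (Suc j))) - expect_ones \<alpha> n True (\<lambda>j. \<phi> (Suc j))"
      using finite_set_markov_from
      by (simp add: \<psi>_def integrable_measure_pmf_finite)
    then have "0 \<le> (\<alpha> - 1/2) * (expect_ones \<alpha> n True (\<lambda>j. \<phi> (Suc (Suc j)))
      - expect_ones \<alpha> n True (\<lambda>j. \<phi> (Suc j))
      - (expect_ones \<alpha> n False (\<lambda>j. \<phi> (Suc j)) - expect_ones \<alpha> n False \<phi>))"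
      using assms by (intro mult_nonneg_nonneg) auto
    \<comment> \<open>On the left the second symbol is an independent fair coin. The right side
      exceeds it by half of the product just shown to be nonnegative.\<close>
    then have step: "((expect_ones \<alpha> n True (\<lambda>j. \<phi> (Suc (Suc j))) + expect_ones \<alpha> n False (\<lambda>j. \<phi> (Suc j))) / 2
        + (expect_ones \<alpha> n True (\<lambda>j. \<phi> (Suc j)) + expect_ones \<alpha> n False \<phi>) / 2) / 2
      \<le> (expect_ones \<alpha> (Suc n) True (\<lambda>j. \<phi> (Suc j)) + expect_ones \<alpha> (Suc n) False \<phi>) / 2"
      unfolding expect_ones_Suc(2)[OF \<alpha>] expect_ones_Suc(1)[OF \<alpha>, of n "\<lambda>j. \<phi> (Suc j)"]
      by (simp add: field_simps)
    have "(\<Sum>j\<le>Suc (Suc n). real (Suc (Suc n) choose j) * \<phi> j) / 2 ^ Suc (Suc n)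
      = ((\<Sum>j\<le>Suc n. real (Suc n choose j) * \<phi> (Suc j)) / 2 ^ Suc n
        + (\<Sum>j\<le>Suc n. real (Suc n choose j) * \<phi> j) / 2 ^ Suc n) / 2"
      unfolding sum_choose_Suc[of "Suc n"]
      by (simp add: add_divide_distrib del: sum.atMost_Suc binomial_Suc_Suc)
    also have "\<dots> \<le> ((expect_ones \<alpha> n True (\<lambda>j. \<phi> (Suc (Suc j))) + expect_ones \<alpha> n False (\<lambda>j. \<phi> (Suc j))) / 2
        + (expect_ones \<alpha> n True (\<lambda>j. \<phi> (Suc j)) + expect_ones \<alpha> n False \<phi>) / 2) / 2"
      by (intro divide_right_mono add_mono Suc.IH[OF Suc.prems] Suc.IH[OF conv]) simp
    also note step
    finally show ?case .
  qed
  from this[of n'] show ?thesis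
    unfolding Suc expectation_markov_word_Suc[OF \<alpha>] by (simp del: sum.atMost_Suc binomial_Suc_Suc)
qed

lemma subseq_replicate_iff: "subseq (replicate m x) w \<longleftrightarrow> m \<le> count_list w x"
proof (induction w arbitrary: m)
  case Nil
  then show ?case by (cases m) auto
next
  case (Cons a w)
  from Cons[of m] Cons[of "m - 1"] show ?case by (cases m) auto
qed

lemma expectation_subseq_constant_word:
  assumes "1/2 \<le> \<alpha>" "\<alpha> \<le> 1" "m \<le> n"
  shows "real (n choose m) / 2 ^ n / real (n + 1) \<le>
    measure_pmf.expectation (markov_word \<alpha> n) (\<lambda>w. of_bool (subseq (replicate m True) w))"
proof -
  \<comment> \<open>Truncated subtraction yields the positive part of \<open>j - m + 1\<close>:
    convex, zero below \<open>m\<close>, equal to 1 at \<open>j = m\<close>, and at most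
    \<open>n + 1\<close> for \<open>j \<le> n\<close>.\<close>
  define \<phi> where "\<phi> j = real (j + 1 - m)" for j
  have \<alpha>: "0 \<le> \<alpha>" "\<alpha> \<le> 1" using assms by auto
  have "real (n choose m) \<le> (\<Sum>j\<le>n. real (n choose j) * \<phi> j)"
    using assms member_le_sum[of m "{..n}" "\<lambda>j. real (n choose j) * \<phi> j"] by (simp add: \<phi>_def)
  then have "real (n choose m) / 2 ^ n \<le> (\<Sum>j\<le>n. real (n choose j) * \<phi> j) / 2 ^ n"
    by (simp add: divide_simps)
  also have "\<dots> \<le> measure_pmf.expectation (markov_word \<alpha> n) (\<lambda>w. \<phi> (count_list w True))"
    using assms by (intro expect_ones_convex) (auto simp: convex_nat_def \<phi>_def)
  also have "\<dots> \<le> measure_pmf.expectation (markov_word \<alpha> n)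
    (\<lambda>w. real (n + 1) * of_bool (subseq (replicate m True) w))"
  proof (intro expectation_mono_finite finite_set_markov_word)
    fix w assume "w \<in> set_pmf (markov_word \<alpha> n)"
    then have "count_list w True \<le> n"
      using length_markov_word count_le_length by metis
    then show "\<phi> (count_list w True) \<le> real (n + 1) * of_bool (subseq (replicate m True) w)"
      by (auto simp: \<phi>_def subseq_replicate_iff)
  qed
  finally show ?thesis
    by (simp add: divide_simps mult_ac)
qed

text \<open>The word depends on whether the chain tends to flip or to stay. The factor
  \<open>n + 1\<close> is lost for constant words and given away for alternating ones, to have a
  single bound.\<close>

lemma ex_likely_subseq:
  assumes "0 \<le> \<alpha>" "\<alpha> \<le> 1" "m \<le> n"
  shows "\<exists>y. length y = m \<and>
    real (n choose m) / 2 ^ n / real (n + 1) \<le> measure_pmf.prob (markov_word \<alpha> n) {w. subseq y w}"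
proof -
  have *: "measure_pmf.expectation (markov_word \<alpha> n) (\<lambda>w. of_bool (subseq y w))
    = measure_pmf.prob (markov_word \<alpha> n) {w. subseq y w}" for y
  proof -
    have "(\<lambda>w. of_bool (subseq y w) :: real) = indicator {w. subseq y w}"
      by (auto simp: indicator_def)
    then show ?thesis by simp
  qed
  show ?thesis
  proof (cases "\<alpha> \<le> 1/2")
    case True
    have "real (n choose m) / 2 ^ n / real (n + 1) \<le> real (n choose m) / 2 ^ n"
      by (simp add: divide_simps) (simp add: distrib_left)
    also note expectation_subseq_alternating_word[OF assms(1) True]
    finally show ?thesis
      unfolding * by (intro exI[of _ "alternating m True"]) auto
  next
    case False
    then show ?thesis
      using expectation_subseq_constant_word[of \<alpha> m n] assms unfolding *
      by (intro exI[of _ "replicate m True"]) auto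
  qed
qed

section \<open>Entropy bound for binomial coefficients\<close>

text \<open>Successive binomial weights have ratio
  \<open>(n - j) * \<delta> / ((j + 1) * (1 - \<delta>))\<close>. They do not decrease up to
  \<open>k\<close> and do not increase from \<open>k + 1\<close> on; the factor 2 covers the one
  step from \<open>k\<close> to \<open>k + 1\<close>.\<close>

lemma binomial_weight_le:
  fixes \<delta> :: real
  assumes "0 < \<delta>" "\<delta> \<le> 1/2" "j \<le> n"
  defines "k \<equiv> nat \<lfloor>\<delta> * real n\<rfloor>"
  shows "real (n choose j) * \<delta> ^ j * (1 - \<delta>) ^ (n - j)
    \<le> 2 * (real (n choose k) * \<delta> ^ k * (1 - \<delta>) ^ (n - k))"
proof -
  define a where "a j = real (n choose j) * \<delta> ^ j * (1 - \<delta>) ^ (n - j)" for j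
  have a_nonneg: "0 \<le> a j" for j
    using assms by (simp add: a_def)
  have k: "real k \<le> \<delta> * n" "\<delta> * n < real k + 1"
    using assms by (auto simp: k_def)
  have step: "a (Suc j) * (real (Suc j) * (1 - \<delta>)) = a j * (real (n - j) * \<delta>)" if "j < n" for j
  proof -
    have n: "n - j = Suc (n - Suc j)"
      using that by simp
    have "a (Suc j) * (real (Suc j) * (1 - \<delta>))
      = (real (Suc j) * real (n choose Suc j)) * (\<delta> ^ Suc j * (1 - \<delta>) ^ Suc (n - Suc j))"
      unfolding a_def by (simp only: power_Suc mult_ac)
    also have "real (Suc j) * real (n choose Suc j) = real (n - j) * real (n choose j)"
      by (metis binomial_absorb_comp binomial_absorption mult.commute of_nat_mult)
    also have "\<dots> * (\<delta> ^ Suc j * (1 - \<delta>) ^ Suc (n - Suc j)) = a j * (real (n - j) * \<delta>)"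
      unfolding a_def n[symmetric] by (simp only: power_Suc mult_ac)
    finally show ?thesis .
  qed
  have kn: "k \<le> n"
  proof -
    have "\<delta> * n \<le> real n" using assms by (simp add: mult_left_le_one_le)
    with k show ?thesis by linarith
  qed
  have up: "a j \<le> a (Suc j)" if "Suc j \<le> k" for j
  proof -
    have jn: "j < n" using that kn by simp
    have "a j * (real (Suc j) * (1 - \<delta>)) \<le> a j * (real (n - j) * \<delta>)"
    proof (intro mult_left_mono a_nonneg)
      have "real (Suc j) \<le> \<delta> * n" using that k by linarith
      then show "real (Suc j) * (1 - \<delta>) \<le> real (n - j) * \<delta>"
        using jn assms by (simp add: of_nat_diff algebra_simps)
    qed
    then have "a j * (real (Suc j) * (1 - \<delta>)) \<le> a (Suc j) * (real (Suc j) * (1 - \<delta>))"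
      using step[OF jn] by simp
    then show ?thesis
      using assms by (simp add: mult_le_cancel_right zero_less_mult_iff)
  qed
  have down: "a (Suc j) \<le> a j" if "Suc k \<le> j" "j < n" for j
  proof -
    have "a j * (real (n - j) * \<delta>) \<le> a j * (real (Suc j) * (1 - \<delta>))"
    proof (intro mult_left_mono a_nonneg)
      have "\<delta> * n \<le> real j" using that k by linarith
      then show "real (n - j) * \<delta> \<le> real (Suc j) * (1 - \<delta>)"
        using that assms by (simp add: of_nat_diff algebra_simps)
    qed
    then have "a (Suc j) * (real (Suc j) * (1 - \<delta>)) \<le> a j * (real (Suc j) * (1 - \<delta>))"
      using step[OF that(2)] by simp
    then show ?thesis
      using assms by (simp add: mult_le_cancel_right zero_less_mult_iff)
  qed
  \<comment> \<open>The factor 2 arises from \<open>1 - \<delta> \<ge> 1/2\<close>.\<close>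
  have mid: "a (Suc k) \<le> 2 * a k" if "k < n"
  proof -
    have "a (Suc k) * (real (Suc k) * (1/2)) \<le> a (Suc k) * (real (Suc k) * (1 - \<delta>))"
      using assms by (intro mult_left_mono a_nonneg) auto
    also have "\<dots> = a k * (real (n - k) * \<delta>)" by (rule step[OF that])
    also have "\<dots> \<le> a k * real (Suc k)"
    proof (intro mult_left_mono a_nonneg)
      have "real (n - k) * \<delta> \<le> \<delta> * n" using assms by (simp add: mult.commute)
      then show "real (n - k) * \<delta> \<le> real (Suc k)" using k by linarith
    qed
    finally have "a (Suc k) * real (Suc k) \<le> (2 * a k) * real (Suc k)"
      by simp
    then show ?thesis by (rule mult_right_le_imp_le) simp
  qed
  have "a j \<le> 2 * a k"
  proof (cases "j \<le> k")
    case True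
    then have "a j \<le> a k"
      by (induction rule: inc_induct) (auto intro: order_trans[OF up])
    then show ?thesis using a_nonneg[of k] by linarith
  next
    case False
    then have "Suc k \<le> j" by simp
    then have "j \<le> n \<longrightarrow> a j \<le> a (Suc k)"
      by (induction rule: dec_induct) (auto intro: order_trans[OF down])
    then show ?thesis using mid False assms by fastforce
  qed
  then show ?thesis unfolding a_def .
qed

text \<open>The \<open>n + 1\<close> binomial weights sum to 1, so the one at the rounded mean is at
  least \<open>1 / (2 * (n + 1))\<close>. Its power factor is
  \<open>2 powr (- bin_entropy \<delta> * n)\<close> up to a constant caused by rounding, so
  \<open>K\<close> depends on \<open>\<delta>\<close> only.\<close>

lemma binomial_entropy_lower_bound:
  assumes "0 \<le> \<delta>" "\<delta> \<le> 1/2"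
  shows "\<exists>K>0. \<forall>n. K * 2 powr (bin_entropy \<delta> * real n) / real (n + 1)
    \<le> real (n choose nat \<lfloor>\<delta> * real n\<rfloor>)"
proof (cases "\<delta> = 0")
  case True
  then show ?thesis by (intro exI[of _ 1]) auto
next
  case False
  then have \<delta>: "0 < \<delta>" "\<delta> < 1" using assms by auto
  define r where "r = \<delta> / (1 - \<delta>)"
  have r: "0 < r" "r \<le> 1" using \<delta> assms by (auto simp: r_def divide_simps)
  have "r / 2 * 2 powr (bin_entropy \<delta> * real n) / real (n + 1)
    \<le> real (n choose nat \<lfloor>\<delta> * real n\<rfloor>)" for n
  proof -
    define k where "k = nat \<lfloor>\<delta> * real n\<rfloor>"
    have k: "real k \<le> \<delta> * n" "\<delta> * n < real k + 1"
      using \<delta> by (auto simp: k_def)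
    have kn: "k \<le> n"
    proof -
      have "\<delta> * n \<le> real n" using \<delta> by (simp add: mult_left_le_one_le)
      with k show ?thesis by linarith
    qed
    have "1 = (\<delta> + (1 - \<delta>)) ^ n" by simp
    also have "\<dots> = (\<Sum>j\<le>n. real (n choose j) * \<delta> ^ j * (1 - \<delta>) ^ (n - j))"
      by (rule binomial_ring)
    also have "\<dots> \<le> (\<Sum>j\<le>n. 2 * (real (n choose k) * \<delta> ^ k * (1 - \<delta>) ^ (n - k)))"
      unfolding k_def using \<delta> assms by (intro sum_mono binomial_weight_le) auto
    also have "\<dots> = 2 * real (n + 1) * real (n choose k) * (\<delta> ^ k * (1 - \<delta>) ^ (n - k))"
      by simp
    finally have 1: "1 \<le> 2 * real (n + 1) * real (n choose k) * (\<delta> ^ k * (1 - \<delta>) ^ (n - k))" .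
    have "\<delta> ^ k * (1 - \<delta>) ^ (n - k) = r powr real k * (1 - \<delta>) powr real n"
      using \<delta> kn by (simp add: r_def powr_realpow power_divide power_diff divide_simps)
    \<comment> \<open>As \<open>r \<le> 1\<close> and \<open>k > \<delta> * n - 1\<close>, lowering
      the exponent enlarges the power; rounding costs at most a factor \<open>1 / r\<close>.\<close>
    also have "\<dots> \<le> r powr (\<delta> * n - 1) * (1 - \<delta>) powr real n"
      using r k by (intro mult_right_mono powr_mono') auto
    also have "\<dots> = 2 powr (- bin_entropy \<delta> * n) / r"
    proof -
      have h: "bin_entropy \<delta> = - (\<delta> * log 2 r) - log 2 (1 - \<delta>)"
        using \<delta> unfolding r_def bin_entropy_def by (simp add: log_divide algebra_simps)
      have "- bin_entropy \<delta> * n = log 2 r * (\<delta> * n) + log 2 (1 - \<delta>) * n"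
        unfolding h by (simp add: algebra_simps)
      then have "2 powr (- bin_entropy \<delta> * n) = 2 powr (log 2 r * (\<delta> * n)) * 2 powr (log 2 (1 - \<delta>) * n)"
        by (simp only: powr_add)
      also have "\<dots> = r powr (\<delta> * n) * (1 - \<delta>) powr n"
        using r \<delta> by (simp add: powr_powr[symmetric])
      finally show ?thesis using r by (simp add: powr_diff)
    qed
    finally have "2 * real (n + 1) * real (n choose k) * (\<delta> ^ k * (1 - \<delta>) ^ (n - k))
      \<le> 2 * real (n + 1) * real (n choose k) * (2 powr (- bin_entropy \<delta> * n) / r)"
      by (intro mult_left_mono) auto
    with 1 have "1 \<le> 2 * real (n + 1) * real (n choose k) * (2 powr (- bin_entropy \<delta> * n) / r)"
      by linarith
    then show ?thesis
      unfolding k_def[symmetric] using r by (simp add: powr_minus field_simps)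
  qed
  then show ?thesis using r by (intro exI[of _ "r / 2"]) auto
qed

section \<open>Lower tail of the number of matching codewords\<close>

text \<open>By independence the expectation factors, each sample contributing the mean of a variable
  that is \<open>1/2\<close> on \<open>P\<close> and 1 elsewhere.\<close>

lemma expectation_half_power_length_filter:
  assumes "finite (set_pmf p)"
  shows "measure_pmf.expectation (replicate_pmf M p) (\<lambda>ws. (1/2) ^ length (filter P ws))
    = (1 - measure_pmf.prob p {x. P x} / 2) ^ M"
proof (induction M)
  case 0
  show ?case by simp
next
  case (Suc M)
  have fin: "finite (set_pmf (replicate_pmf M p))"
    using assms by (induction M) auto
  have "measure_pmf.expectation (replicate_pmf (Suc M) p) (\<lambda>ws. (1/2) ^ length (filter P ws))
    = (\<Sum>x\<in>set_pmf p. pmf p x * ((if P x then 1/2 else 1) *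
        measure_pmf.expectation (replicate_pmf M p) (\<lambda>ws. (1/2) ^ length (filter P ws))))"
    using assms fin
    by (simp add: map_pmf_def[symmetric] pmf_expectation_bind[of "set_pmf p"])
       (intro sum.cong refl, auto)
  also have "\<dots> = (\<Sum>x\<in>set_pmf p. pmf p x * (if P x then 1/2 else 1))
      * (1 - measure_pmf.prob p {x. P x} / 2) ^ M"
    unfolding Suc.IH by (simp add: sum_distrib_right mult.assoc)
  also have "(\<Sum>x\<in>set_pmf p. pmf p x * (if P x then 1/2 else 1))
    = measure_pmf.expectation p (\<lambda>x. 1 - indicator {x. P x} x / 2)"
    using assms by (subst integral_measure_pmf[of "set_pmf p"]) (auto intro!: sum.cong simp: set_pmf_iff)
  also have "\<dots> = 1 - measure_pmf.prob p {x. P x} / 2"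
    using assms by (simp add: integrable_measure_pmf_finite)
  finally show ?case by simp
qed

text \<open>Chernoff bound with base \<open>1/2\<close>: since 2 is at most \<open>exp 1\<close>,
  the quantity \<open>exp t * (1/2) ^ j\<close> is at least 1 for \<open>j < t\<close> and so
  dominates the indicator. The product form of its mean is then bounded by
  \<open>1 - x \<le> exp (- x)\<close>.\<close>

lemma prob_length_filter_less:
  assumes "finite (set_pmf p)" "0 \<le> t"
  shows "measure_pmf.prob (replicate_pmf M p) {ws. real (length (filter P ws)) < t}
    \<le> exp (t - real M * measure_pmf.prob p {x. P x} / 2)"
proof -
  define q where "q = measure_pmf.prob p {x. P x}"
  have q: "0 \<le> q" "q \<le> 1" by (auto simp: q_def)
  have fin: "finite (set_pmf (replicate_pmf M p))"
    using assms by (induction M) auto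
  have "measure_pmf.prob (replicate_pmf M p) {ws. real (length (filter P ws)) < t}
    = measure_pmf.expectation (replicate_pmf M p) (indicator {ws. real (length (filter P ws)) < t})"
    by simp
  also have "\<dots> \<le> measure_pmf.expectation (replicate_pmf M p) (\<lambda>ws. exp t * (1/2) ^ length (filter P ws))"
  proof (intro expectation_mono_finite fin)
    fix ws
    have "(1::real) \<le> exp t * (1/2) ^ j" if "real j < t" for j
    proof -
      have "(2::real) ^ j \<le> exp 1 ^ j"
        using exp_ge_add_one_self[of 1] by (intro power_mono) auto
      also have "\<dots> \<le> exp t"
        using that by (simp add: exp_of_nat_mult[symmetric])
      finally show ?thesis by (simp add: power_divide divide_simps)
    qed
    then show "indicator {ws. real (length (filter P ws)) < t} ws \<le> exp t * (1/2) ^ length (filter P ws)"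
      by (auto simp: indicator_def)
  qed
  also have "\<dots> = exp t * (1 - q / 2) ^ M"
    using expectation_half_power_length_filter[OF assms(1)] by (simp add: q_def)
  also have "\<dots> \<le> exp t * exp (- (q / 2)) ^ M"
    using q exp_ge_add_one_self[of "- (q / 2)"] by (intro mult_left_mono power_mono) auto
  also have "\<dots> = exp (t - real M * q / 2)"
    by (simp add: exp_of_nat_mult[symmetric] exp_add[symmetric])
  finally show ?thesis unfolding q_def .
qed

text \<open>A fixed \<open>y\<close> already witnesses the existential event, so only the lower tail
  of its own count enters.\<close>

lemma prob_random_code_ge:
  assumes "0 \<le> \<alpha>" "\<alpha> \<le> 1" "0 \<le> t" "length y = m"
  shows "1 - exp (t - real M * measure_pmf.prob (markov_word \<alpha> n) {w. subseq y w} / 2)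
    \<le> measure_pmf.prob (random_code M \<alpha> n)
      {C. \<exists>y. length y = m \<and> real (size {# w \<in># C. subseq y w #}) \<ge> t}"
proof -
  let ?D = "replicate_pmf M (markov_word \<alpha> n)"
  let ?A = "{ws. real (length (filter (subseq y) ws)) < t}"
  have "1 - exp (t - real M * measure_pmf.prob (markov_word \<alpha> n) {w. subseq y w} / 2)
    \<le> 1 - measure_pmf.prob ?D ?A"
    using prob_length_filter_less[OF finite_set_markov_word assms(3)] by simp
  also have "\<dots> = measure_pmf.prob ?D (- ?A)"
    using measure_pmf.prob_compl[of ?A ?D] by (simp add: Compl_eq_Diff_UNIV)
  also have "\<dots> \<le> measure_pmf.prob ?D (mset -` {C. \<exists>y. length y = m \<and>
      real (size {# w \<in># C. subseq y w #}) \<ge> t})"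
  proof (intro measure_pmf.finite_measure_mono subsetI)
    fix ws assume "ws \<in> - ?A"
    \<comment> \<open>Forgetting the order of the samples keeps the multiplicity of repeated
      codewords.\<close>
    moreover have "size {# w \<in># mset ws. subseq y w #} = length (filter (subseq y) ws)"
      by (metis mset_filter size_mset)
    ultimately show "ws \<in> mset -` {C. \<exists>y. length y = m \<and> real (size {# w \<in># C. subseq y w #}) \<ge> t}"
      using assms(4) by auto
  qed auto
  finally show ?thesis
    unfolding random_code_def by simp
qed

section \<open>Expected number of matching codewords and passage to the limit\<close>

theorem theorem1p2:
  shows "\<exists>c::real. c > 0 \<and>
    (\<forall>\<delta>::real. \<forall>\<epsilon>::real. \<forall>\<alpha>::real. \<forall>R::real.
       0 \<le> \<delta> \<longrightarrow> \<delta> \<le> 1/2 \<longrightarrow> \<epsilon> > 0 \<longrightarrow> 0 \<le> \<alpha> \<longrightarrow> \<alpha> \<le> 1 \<longrightarrow>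
       R = 1 - bin_entropy \<delta> + \<epsilon> \<longrightarrow>
       (\<lambda>n::nat. measure_pmf.prob
            (random_code (nat \<lfloor>2 powr (R * real n)\<rfloor>) \<alpha> n)
            {C. \<exists>y :: bool list. length y = n - nat \<lfloor>\<delta> * real n\<rfloor> \<and>
                  real (size {# w \<in># C. subseq y w #}) \<ge> 2 powr (c * \<epsilon> * real n)})
         \<longlonglongrightarrow> 1)"
proof (intro exI[of _ "1/2"] conjI allI impI)
  fix \<delta> \<epsilon> \<alpha> R :: real
  assume \<delta>: "0 \<le> \<delta>" "\<delta> \<le> 1/2" and \<epsilon>: "\<epsilon> > 0" and \<alpha>: "0 \<le> \<alpha>" "\<alpha> \<le> 1"
    and R: "R = 1 - bin_entropy \<delta> + \<epsilon>"
  obtain K where K: "K > 0"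
    "\<And>n. K * 2 powr (bin_entropy \<delta> * real n) / real (n + 1) \<le> real (n choose nat \<lfloor>\<delta> * real n\<rfloor>)"
    using binomial_entropy_lower_bound[OF \<delta>] by blast
  let ?P = "\<lambda>n::nat. measure_pmf.prob
            (random_code (nat \<lfloor>2 powr (R * real n)\<rfloor>) \<alpha> n)
            {C. \<exists>y :: bool list. length y = n - nat \<lfloor>\<delta> * real n\<rfloor> \<and>
                  real (size {# w \<in># C. subseq y w #}) \<ge> 2 powr (1/2 * \<epsilon> * real n)}"
  \<comment> \<open>The tail bound with the mean replaced by an explicit lower estimate: one factor
    \<open>n + 1\<close> comes from the likely subsequence, one from the entropy bound, and the
    \<open>- 1\<close> from rounding the number of codewords.\<close>
  define f where "f n = 1 - exp (2 powr (1/2 * \<epsilon> * real n)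
    - (K * 2 powr (\<epsilon> * real n) / (real n + 1)\<^sup>2 - 1) / 2)" for n :: nat
  have "f n \<le> ?P n" for n
  proof -
    define k where "k = nat \<lfloor>\<delta> * real n\<rfloor>"
    define M where "M = nat \<lfloor>2 powr (R * real n)\<rfloor>"
    have kn: "k \<le> n"
    proof -
      have "\<delta> * n \<le> real n" using \<delta> by (simp add: mult_left_le_one_le)
      moreover have "real k \<le> \<delta> * n" using \<delta> by (simp add: k_def)
      ultimately show ?thesis by linarith
    qed
    obtain y where y: "length y = n - k"
      "real (n choose (n - k)) / 2 ^ n / real (n + 1) \<le> measure_pmf.prob (markov_word \<alpha> n) {w. subseq y w}"
      using ex_likely_subseq[OF \<alpha>, of "n - k" n] by auto
    define p where "p = measure_pmf.prob (markov_word \<alpha> n) {w. subseq y w}"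
    have p: "0 \<le> p" "p \<le> 1" by (auto simp: p_def)
    have "K * 2 powr (bin_entropy \<delta> * real n) / real (n + 1) / 2 ^ n / real (n + 1)
      \<le> real (n choose k) / 2 ^ n / real (n + 1)"
      using K(2)[of n] unfolding k_def by (intro divide_right_mono) auto
    also have "\<dots> \<le> p"
      using y(2) binomial_symmetric[OF kn] by (simp add: p_def)
    finally have "2 powr (R * n) * (K * 2 powr (bin_entropy \<delta> * real n) / real (n + 1) / 2 ^ n / real (n + 1))
      \<le> 2 powr (R * n) * p"
      by (intro mult_left_mono) auto
    also have "2 powr (R * n) * (K * 2 powr (bin_entropy \<delta> * real n) / real (n + 1) / 2 ^ n / real (n + 1))
      = K * (2 powr (R * n) * 2 powr (bin_entropy \<delta> * real n) / 2 powr n) / (real n + 1)\<^sup>2"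
      by (simp add: powr_realpow power2_eq_square add.commute mult_ac)
    \<comment> \<open>The choice of \<open>R\<close> cancels both the entropy and the factor
      \<open>2 ^ n\<close>.\<close>
    also have "2 powr (R * n) * 2 powr (bin_entropy \<delta> * real n) / 2 powr n = 2 powr (\<epsilon> * n)"
      unfolding powr_add[symmetric] powr_diff[symmetric] by (simp add: R algebra_simps)
    \<comment> \<open>Rounding down loses less than one codeword, hence at most
      \<open>p \<le> 1\<close> in the mean.\<close>
    also have "2 powr (R * n) * p \<le> (real M + 1) * p"
      using p unfolding M_def by (intro mult_right_mono) linarith+
    also have "\<dots> \<le> real M * p + 1"
      using p by (simp add: algebra_simps)
    finally have "(K * 2 powr (\<epsilon> * n) / (real n + 1)\<^sup>2 - 1) / 2 \<le> real M * p / 2"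
      by (intro divide_right_mono) (simp_all add: diff_le_eq)
    then have "f n \<le> 1 - exp (2 powr (1/2 * \<epsilon> * real n) - real M * p / 2)"
      by (simp add: f_def)
    also have "\<dots> \<le> ?P n"
      using prob_random_code_ge[OF \<alpha> _ y(1), of "2 powr (1/2 * \<epsilon> * real n)" M]
      unfolding p_def M_def k_def by simp
    finally show ?thesis .
  qed
  \<comment> \<open>Even divided by a polynomial, \<open>2 powr (\<epsilon> * n)\<close> outgrows
    the threshold \<open>2 powr (1/2 * \<epsilon> * n)\<close>, so the exponent tends to minus
    infinity.\<close>
  moreover have "f \<longlonglongrightarrow> 1"
    unfolding f_def using \<epsilon> K(1) by real_asymp
  ultimately show "?P \<longlonglongrightarrow> 1"
    by (intro tendsto_sandwich[of f ?P sequentially "\<lambda>_. 1"]) auto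
qed auto

end
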